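(* Let $p$ be an odd prime and let $q\in\mathbb{C}_p$ with $|1-q|_p<1$. Let $s\in\mathbb{N}$ and $n_1,\dots,n_s,k\in\mathbb{Z}_+$ with $n_1+\cdots+n_s>sk$. Then $$\int_{\mathbb{Z}_p}\Big(\prod_{i=1}^{s}B_{k,n_i}(x)\Big)q^{1-x}\,d\mu_{-1}(x)=\begin{cases}2q+E_{n_1+\cdots+n_s,q}, & k=0,\\[1mm] \Big(\displaystyle\prod_{i=1}^{s}\binom{n_i}{k}\Big)\displaystyle\sum_{j=0}^{sk}\binom{sk}{j}(-1)^{sk+j}E_{n_1+\cdots+n_s-j,q}, & k>0.\end{cases}$$
   Context: $\mathbb{C}_p$ denotes the completion of an algebraic closure of $\mathbb{Q}_p$; $\mathbb{N}=\{1,2,\dots\}$, $\mathbb{Z}_+=\{0,1,2,\dots\}$. For $q\in\mathbb{C}_p$ with $|1-q|_p<1$, the $q$-Euler numbers $E_{n,q}$ are defined by $\frac{2}{qe^t+1}=\sum_{n\ge0}E_{n,q}\frac{t^n}{n!}$ (formal power series in $t$). For $x\in\mathbb{Z}_p$, $q^x=\sum_{r\ge0}\binom{x}{r}(q-1)^r$ and $q^{1-x}=q\cdot(q^{-1})^x$. Binomial coefficients are $\binom{n}{k}=\frac{n(n-1)\cdots(n-k+1)}{k!}$ (zero when $k>n$), and the Bernstein polynomial is $B_{k,n}(x)=\binom{n}{k}x^k(1-x)^{n-k}$, regarded as a polynomial function on $\mathbb{Z}_p$ (the zero polynomial when $k>n$). For a uniformly differentiable $f:\mathbb{Z}_p\to\mathbb{C}_p$,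 the fermionic $p$-adic integral is $\int_{\mathbb{Z}_p}f(x)\,d\mu_{-1}(x)=\lim_{N\to\infty}\sum_{x=0}^{p^N-1}f(x)(-1)^x$. *)

theory Defs
  imports "HOL-Analysis.Analysis" "HOL-Computational_Algebra.Computational_Algebra"
begin

text \<open>Fields of characteristic 0 with a multiplicative non-archimedean absolute value inducing the
  metric. The library's \<open>norm\<close> cannot be used here, as it is restricted to real normed vector spaces.\<close>

class valued_field = field_char_0 + metric_space +
  fixes absv :: "'a \<Rightarrow> real"
  assumes dist_absv: "dist x y = absv (x - y)"
    and absv_mult: "absv (x * y) = absv x * absv y"
    and absv_add_le_max: "absv (x + y) \<le> max (absv x) (absv y)"

definition padic_abs :: "nat \<Rightarrow> rat \<Rightarrow> real" where
  "padic_abs p r = (if r = 0 then 0 else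
     (case quotient_of r of (a, b) \<Rightarrow>
        real p powi (int (multiplicity (int p) b) - int (multiplicity (int p) a))))"

definition is_subfield :: "'a::field set \<Rightarrow> bool" where
  "is_subfield A \<longleftrightarrow> 0 \<in> A \<and> 1 \<in> A \<and>
     (\<forall>x\<in>A. \<forall>y\<in>A. x - y \<in> A \<and> x * y \<in> A) \<and> (\<forall>x\<in>A. inverse x \<in> A)"

definition is_alg_closure_of :: "'a::field set \<Rightarrow> 'a set \<Rightarrow> bool" where
  "is_alg_closure_of A F \<longleftrightarrow> is_subfield F \<and> is_subfield A \<and> F \<subseteq> A \<and>
     (\<forall>x\<in>A. \<exists>f. f \<noteq> 0 \<and> set (coeffs f) \<subseteq> F \<and> poly f x = 0) \<and>
     (\<forall>f. set (coeffs f) \<subseteq> A \<and> degree f > 0 \<longrightarrow> (\<exists>x\<in>A. poly f x = 0))"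

definition is_completion_of :: "'a::metric_space set \<Rightarrow> 'a set \<Rightarrow> bool" where
  "is_completion_of K A \<longleftrightarrow> A \<subseteq> K \<and> complete K \<and> K \<subseteq> closure A"

text \<open>The type \<open>'a\<close> is a copy of \<open>\<complex>\<^sub>p\<close>: the completion of an algebraic closure \<open>A\<close> of the completion
  \<open>Qp\<close> of the rationals with respect to the \<open>p\<close>-adic absolute value. A predicate on types is used
  because a HOL type cannot depend on the number \<open>p\<close>.\<close>

definition is_Cp :: "nat \<Rightarrow> 'a::valued_field itself \<Rightarrow> bool" where
  "is_Cp p _ \<longleftrightarrow> (\<forall>r. absv (of_rat r :: 'a) = padic_abs p r) \<and>
     (\<exists>Qp A :: 'a set. is_completion_of Qp (range of_rat) \<and> is_alg_closure_of A Qp \<and>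
        is_completion_of UNIV A)"

definition q_Euler :: "nat \<Rightarrow> 'a::field_char_0 \<Rightarrow> 'a" where
  "q_Euler n q = fact n * fps_nth (fps_const 2 / (fps_const q * fps_exp 1 + 1)) n"

text \<open>Only meaningful for \<open>absv (1 - q) < 1\<close> and \<open>x\<close> in the closure of the integers.\<close>

definition qpow :: "'a::valued_field \<Rightarrow> 'a \<Rightarrow> 'a" where
  "qpow q x = (\<Sum>r. (x gchoose r) * (q - 1) ^ r)"

definition bernstein :: "nat \<Rightarrow> nat \<Rightarrow> 'a::field_char_0 \<Rightarrow> 'a" where
  "bernstein k n x = of_nat (n choose k) * x ^ k * (1 - x) ^ (n - k)"

text \<open>The integral of \<open>f\<close> over \<open>\<int>\<^sub>p\<close> exists as a limit and equals \<open>I\<close>; only the values of \<open>f\<close> at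
  natural numbers matter, so \<open>f\<close> is taken to be total.\<close>

definition has_fermionic_integral :: "nat \<Rightarrow> ('a::valued_field \<Rightarrow> 'a) \<Rightarrow> 'a \<Rightarrow> bool" where
  "has_fermionic_integral p f I \<longleftrightarrow>
     (\<lambda>N. \<Sum>x<p ^ N. f (of_nat x) * (- 1) ^ x) \<longlonglongrightarrow> I"

end

theory Submission
  imports Defs
begin

text \<open>Write \<open>w = q e\<^sup>t\<close> and \<open>M = p\<^sup>N\<close>. Since \<open>M\<close> is odd, the exponential generating function of the
  moments \<open>\<Sum>x<M. (1 - x)\<^sup>n q\<^sup>1\<^sup>-\<^sup>x (-1)\<^sup>x\<close> is a geometric sum equal to \<open>w\<^sup>2 (1 + w\<^sup>-\<^sup>M) / (1 + w)\<close>,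
  which is \<open>D (1 + w\<^sup>-\<^sup>M) / 2\<close> with \<open>D = 2 w - 2 + 2 / (1 + w)\<close>. As \<open>q\<^sup>M\<close> tends to 1 and \<open>M\<close> tends
  to 0 in the \<open>p\<close>-adic topology, the coefficients converge to those of \<open>D\<close>, so the \<open>n\<close>-th moment tends to
  \<open>2 q + E\<^sub>n\<close> for \<open>n > 0\<close>. Expanding \<open>x\<^sup>m = (1 - (1 - x))\<^sup>m\<close> reduces products of Bernstein
  polynomials to these moments.\<close>

section \<open>Elementary properties of the ultrametric absolute value\<close>

lemma absv_nonneg: "0 \<le> absv (x :: 'a::valued_field)"
  by (metis diff_zero dist_absv zero_le_dist)

lemma absv_eq_0_iff: "absv (x :: 'a::valued_field) = 0 \<longleftrightarrow> x = 0"
  by (metis diff_zero dist_absv dist_eq_0_iff)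

lemma absv_zero: "absv (0 :: 'a::valued_field) = 0"
  by (simp add: absv_eq_0_iff)

lemma absv_one: "absv (1 :: 'a::valued_field) = 1"
  by (metis absv_eq_0_iff absv_mult mult_cancel_left1 mult_1 one_neq_zero)

lemma absv_minus_commute: "absv (x - y :: 'a::valued_field) = absv (y - x)"
  by (metis dist_absv dist_commute)

lemma absv_inverse: "absv (inverse x :: 'a::valued_field) = inverse (absv x)"
  by (metis absv_eq_0_iff absv_mult absv_one inverse_unique inverse_zero right_inverse)

lemma absv_power: "absv (x ^ n :: 'a::valued_field) = absv x ^ n"
  by (induction n) (auto simp: absv_one absv_mult)

lemma absv_sum_le:
  fixes f :: "'b \<Rightarrow> 'a::valued_field"
  assumes "\<And>i. i \<in> A \<Longrightarrow> absv (f i) \<le> c" and "0 \<le> c"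
  shows "absv (sum f A) \<le> c"
  using assms
proof (induction A rule: infinite_finite_induct)
  case (insert x F)
  have "absv (f x) \<le> c" "absv (sum f F) \<le> c"
    using insert by auto
  then show ?case
    using insert.hyps absv_add_le_max[of "f x" "sum f F"] by simp
qed (auto simp: absv_zero)

section \<open>Continuity of addition and multiplication, and limits of powers\<close>

lemma tendsto_absv_iff:
  fixes l :: "'a::valued_field"
  shows "(f \<longlongrightarrow> l) F \<longleftrightarrow> ((\<lambda>x. absv (f x - l)) \<longlongrightarrow> 0) F"
  by (subst tendsto_dist_iff) (simp add: dist_absv)

text \<open>This instance and the next make \<open>tendsto_add\<close>, \<open>tendsto_sum\<close>
  and \<open>tendsto_mult\<close> available for limits in a \<open>valued_field\<close>.\<close>

instance valued_field \<subseteq> topological_comm_monoid_add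
proof
  fix a b :: 'a
  show "((\<lambda>x. fst x + snd x) \<longlongrightarrow> a + b) (nhds a \<times>\<^sub>F nhds b)"
  proof (subst tendsto_absv_iff, rule Lim_null_comparison)
    let ?g = "\<lambda>x. dist (fst x) a + dist (snd x) b"
    show "\<forall>\<^sub>F x in nhds a \<times>\<^sub>F nhds b. norm (absv (fst x + snd x - (a + b))) \<le> ?g x"
    proof (rule always_eventually, rule allI)
      fix x :: "'a \<times> 'a"
      show "norm (absv (fst x + snd x - (a + b))) \<le> ?g x"
        using absv_add_le_max[of "fst x - a" "snd x - b"] absv_nonneg[of "fst x - a"]
          absv_nonneg[of "snd x - b"] absv_nonneg[of "fst x + snd x - (a + b)"]
        by (simp add: dist_absv algebra_simps)
    qed
    have "(?g \<longlongrightarrow> dist a a + dist b b) (nhds a \<times>\<^sub>F nhds b)"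
      by (intro tendsto_add tendsto_dist tendsto_const filterlim_fst filterlim_snd)
    then show "(?g \<longlongrightarrow> 0) (nhds a \<times>\<^sub>F nhds b)" by simp
  qed
qed

instance valued_field \<subseteq> topological_semigroup_mult
proof
  fix a b :: 'a
  show "((\<lambda>x. fst x * snd x) \<longlongrightarrow> a * b) (nhds a \<times>\<^sub>F nhds b)"
  proof (subst tendsto_absv_iff, rule Lim_null_comparison)
    let ?g = "\<lambda>x. dist (fst x) a * dist (snd x) 0 + absv a * dist (snd x) b"
    show "\<forall>\<^sub>F x in nhds a \<times>\<^sub>F nhds b. norm (absv (fst x * snd x - a * b)) \<le> ?g x"
    proof (rule always_eventually, rule allI)
      fix x :: "'a \<times> 'a"
      \<comment> \<open>The factor \<open>snd x\<close> is left moving: \<open>?g\<close> measures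
        it by \<open>dist (snd x) 0\<close>, which converges to \<open>absv b\<close>, so no
        separate boundedness argument is needed.\<close>
      have "fst x * snd x - a * b = (fst x - a) * snd x + a * (snd x - b)"
        by (simp add: algebra_simps)
      then have "absv (fst x * snd x - a * b)
          \<le> max (absv (fst x - a) * absv (snd x)) (absv a * absv (snd x - b))"
        by (metis absv_add_le_max absv_mult)
      also have "\<dots> \<le> absv (fst x - a) * absv (snd x) + absv a * absv (snd x - b)"
        by (simp add: absv_nonneg)
      finally show "norm (absv (fst x * snd x - a * b)) \<le> ?g x"
        by (simp add: dist_absv absv_nonneg)
    qed
    have "(?g \<longlongrightarrow> dist a a * dist b 0 + absv a * dist b b) (nhds a \<times>\<^sub>F nhds b)"
      by (intro tendsto_add tendsto_mult tendsto_dist tendsto_const filterlim_fst filterlim_snd)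
    then show "(?g \<longlongrightarrow> 0) (nhds a \<times>\<^sub>F nhds b)" by simp
  qed
qed

lemma tendsto_power_valued:
  fixes l :: "'a::valued_field"
  assumes "(f \<longlongrightarrow> l) F"
  shows "((\<lambda>x. f x ^ n) \<longlongrightarrow> l ^ n) F"
  by (induction n) (auto intro!: tendsto_mult assms)

lemma tendsto_power_zero_valued:
  fixes x :: "'a::valued_field"
  assumes "absv x < 1"
  shows "(\<lambda>N. x ^ N) \<longlonglongrightarrow> 0"
  unfolding tendsto_absv_iff using assms
  by (simp add: absv_power absv_nonneg LIMSEQ_power_zero)

text \<open>The closed ball of radius \<open>c\<close> \<le> 1 about 1 is stable under
  multiplication by \<open>y\<close>, because \<open>y\<close> has absolute value at most 1.\<close>

lemma absv_power_minus_one_le: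
  fixes y :: "'a::valued_field"
  assumes "absv (y - 1) \<le> c" and "c \<le> 1"
  shows "absv (y ^ i - 1) \<le> c"
proof (induction i)
  case 0
  then show ?case using assms absv_nonneg[of "y - 1"] by (simp add: absv_zero)
next
  case (Suc i)
  have y: "absv y \<le> 1"
    using absv_add_le_max[of "y - 1" 1] assms by (simp add: absv_one)
  have step: "absv (y * (y ^ i - 1)) \<le> 1 * c"
    unfolding absv_mult using y Suc by (intro mult_mono) (auto simp: absv_nonneg)
  have "y ^ Suc i - 1 = y * (y ^ i - 1) + (y - 1)"
    by (simp add: algebra_simps)
  then have "absv (y ^ Suc i - 1) \<le> max (absv (y * (y ^ i - 1))) (absv (y - 1))"
    using absv_add_le_max[of "y * (y ^ i - 1)" "y - 1"] by (simp only:)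
  also have "\<dots> \<le> c"
    using step assms(1) by simp
  finally show ?case .
qed

text \<open>In z^p - 1 = (z - 1)(1 + z + ... + z^(p-1)) the second factor differs from p by a sum of
  small terms z^i - 1. So each p-th power shrinks the distance to 1 by the factor \<open>c\<close> <
  1.\<close>

lemma tendsto_power_prime_power_one:
  fixes y :: "'a::valued_field"
  assumes y: "absv (y - 1) < 1" and p: "absv (of_nat p :: 'a) < 1"
  shows "(\<lambda>N. y ^ (p ^ N)) \<longlonglongrightarrow> 1"
proof -
  define c where "c = max (absv (y - 1)) (absv (of_nat p :: 'a))"
  have c: "0 \<le> c" "c < 1"
    using y p absv_nonneg[of "y - 1"] by (auto simp: c_def)
  have step: "absv (z ^ p - 1) \<le> c * absv (z - 1)" if z: "absv (z - 1) \<le> c" for z :: 'a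
  proof -
    have "absv (\<Sum>i<p. z ^ i - 1) \<le> c"
      using absv_power_minus_one_le[OF z] c by (intro absv_sum_le) auto
    moreover have "(\<Sum>i<p. z ^ i) = (\<Sum>i<p. z ^ i - 1) + of_nat p"
      by (simp add: sum_subtractf)
    ultimately have "absv (\<Sum>i<p. z ^ i) \<le> c"
      using absv_add_le_max[of "\<Sum>i<p. z ^ i - 1" "of_nat p"] by (simp add: c_def)
    moreover have "z ^ p - 1 = (z - 1) * (\<Sum>i<p. z ^ i)"
      by (rule power_diff_1_eq)
    ultimately show ?thesis
      by (metis absv_mult absv_nonneg mult.commute mult_left_mono)
  qed
  have bound: "absv (y ^ (p ^ N) - 1) \<le> c * c ^ N" for N
  proof (induction N)
    case 0
    then show ?case by (simp add: c_def)
  next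
    case (Suc N)
    \<comment> \<open>The contraction \<open>step\<close> holds only inside the ball of radius
      \<open>c\<close>; the induction hypothesis keeps the iterates there.\<close>
    have "c * c ^ N \<le> c"
      using c by (simp add: mult_left_le power_le_one)
    then have "absv ((y ^ p ^ N) ^ p - 1) \<le> c * absv (y ^ p ^ N - 1)"
      using Suc by (intro step) simp
    also have "\<dots> \<le> c * (c * c ^ N)"
      using Suc c by (intro mult_left_mono)
    finally show ?case
      by (simp add: power_mult [symmetric] mult.commute)
  qed
  have "(\<lambda>N. c * c ^ N) \<longlonglongrightarrow> 0"
    using c tendsto_mult_right_zero[OF LIMSEQ_power_zero[of c]] by simp
  then show ?thesis
    unfolding tendsto_absv_iff
    by (rule Lim_null_comparison[rotated]) (simp add: bound absv_nonneg)
qed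

section \<open>Generating function of the moments, and their limits\<close>

lemma moment_generating_function:
  fixes q :: "'a::field_char_0"
  assumes q: "q \<noteq> 0" "1 + q \<noteq> 0" and M: "odd M"
  defines "w \<equiv> fps_const q * fps_exp 1"
  defines "D \<equiv> 2 * w - 2 + fps_const 2 / (w + 1)"
  shows "2 * (\<Sum>x<M. fps_const (q * inverse q ^ x * (- 1) ^ x) * fps_exp (1 - of_nat x))
       = D + D * (fps_const (inverse q ^ M) * fps_exp (- of_nat M))"
proof -
  \<comment> \<open>\<open>W\<close> is the inverse of \<open>w\<close>, so the sum becomes
    geometric with ratio \<open>- W\<close>.\<close>
  define W where "W = fps_const (inverse q) * fps_exp (- 1 :: 'a)"
  have W_pow: "W ^ x = fps_const (inverse q ^ x) * fps_exp (- of_nat x)" for x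
    by (simp add: W_def power_mult_distrib fps_exp_power_mult)
  have "fps_exp (1 :: 'a) * fps_exp (- 1) = 1"
    by (simp flip: fps_exp_add_mult)
  moreover have "fps_const q * fps_const (inverse q) = 1"
    using q(1) by simp
  moreover have "w * W = (fps_const q * fps_const (inverse q)) * (fps_exp 1 * fps_exp (- 1))"
    unfolding w_def W_def by (simp only: mult_ac)
  ultimately have wW: "w * W = 1"
    by simp
  have summand: "fps_const (q * inverse q ^ x * (- 1) ^ x) * fps_exp (1 - of_nat x)
      = w * (- W) ^ x" for x
  proof -
    have "fps_exp (1 - of_nat x :: 'a) = fps_exp 1 * fps_exp (- of_nat x)"
      by (simp flip: fps_exp_add_mult)
    moreover have "(- W) ^ x = fps_const ((- 1) ^ x) * W ^ x"
      by (cases "even x") (simp_all flip: fps_const_neg)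
    ultimately show ?thesis
      by (simp only: W_pow w_def mult_ac flip: fps_const_mult)
  qed
  define G where "G = (\<Sum>x<M. w * (- W) ^ x)"
  \<comment> \<open>The constant term \<open>1 + q\<close> decides whether \<open>w + 1\<close> is a
    unit among the power series.\<close>
  have nz: "fps_nth (w + 1) 0 \<noteq> 0"
    using q(2) by (simp add: w_def add.commute)
  then have w1: "w + 1 \<noteq> 0" by (metis fps_zero_nth)
  have E: "fps_const 2 / (w + 1) * (w + 1) = 2"
    unfolding fps_divide_unit[OF nz] mult.assoc inverse_mult_eq_1[OF nz]
    by (simp add: numeral_fps_const)
  \<comment> \<open>Oddness of \<open>M\<close> turns 1 - (-W)^M into 1 + W^M.\<close>
  have geo: "(1 + W) * (\<Sum>x<M. (- W) ^ x) = 1 + W ^ M"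
    using one_diff_power_eq[of "- W" M] M by simp
  have "(w + 1) * G = (w * (1 + W)) * (w * (\<Sum>x<M. (- W) ^ x))"
    by (simp add: G_def sum_distrib_left wW distrib_left)
  also have "\<dots> = w\<^sup>2 * (1 + W ^ M)"
    unfolding geo [symmetric] power2_eq_square by (simp only: mult_ac)
  finally have G: "(w + 1) * G = w\<^sup>2 * (1 + W ^ M)" .
  \<comment> \<open>\<open>D\<close> comes from dividing 2 w^2 by w + 1: quotient 2 w - 2, remainder
    2.\<close>
  have "(w + 1) * D = (w + 1) * (2 * w - 2) + fps_const 2 / (w + 1) * (w + 1)"
    by (simp add: D_def algebra_simps)
  also have "\<dots> = 2 * w\<^sup>2"
    unfolding E by (simp add: algebra_simps power2_eq_square)
  finally have D: "(w + 1) * D = 2 * w\<^sup>2" .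
  have "(w + 1) * (2 * G) = 2 * ((w + 1) * G)"
    by (simp only: mult_ac)
  also have "\<dots> = (w + 1) * D * (1 + W ^ M)"
    unfolding G D by (simp only: mult_ac)
  also have "\<dots> = (w + 1) * (D + D * W ^ M)"
    by (simp only: distrib_left mult.assoc mult_1_right)
  finally have "(w + 1) * (2 * G) = (w + 1) * (D + D * W ^ M)" .
  then have "2 * G = D + D * W ^ M"
    using w1 by simp
  then show ?thesis
    by (simp only: G_def summand W_pow)
qed

text \<open>At a natural number the binomial series terminates and is the expansion of ((q - 1) +
  1)^x. These are the only points that the integral samples.\<close>

lemma qpow_of_nat: "qpow q (of_nat x) = (q :: 'a::valued_field) ^ x"
proof -
  have "qpow q (of_nat x) = (\<Sum>r\<le>x. (of_nat x gchoose r) * (q - 1) ^ r)"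
    unfolding qpow_def
    by (rule suminf_finite) (auto simp: binomial_gbinomial [symmetric] binomial_eq_0)
  also have "\<dots> = ((q - 1) + 1) ^ x"
    by (subst binomial_ring) (simp add: binomial_gbinomial)
  finally show ?thesis by simp
qed

text \<open>Each coefficient of the generating function is a finite Cauchy sum, so limits pass
  through it. The correction at \<open>n = 0\<close> is the constant term of the summand -2 of
  \<open>D\<close>.\<close>

lemma moment_limit:
  fixes q :: "'a::valued_field"
  assumes p: "odd p" "absv (of_nat p :: 'a) < 1" and q: "absv (1 - q) < 1" "1 + q \<noteq> 0"
  shows "(\<lambda>N. \<Sum>x<p ^ N. (1 - of_nat x) ^ n * (q * inverse q ^ x) * (- 1) ^ x)
    \<longlonglongrightarrow> 2 * q - (if n = 0 then 2 else 0) + q_Euler n q"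
proof -
  define w where "w = fps_const q * fps_exp 1"
  define D where "D = 2 * w - 2 + fps_const 2 / (w + 1)"
  \<comment> \<open>This carries the bound on \<open>1 - q\<close> over to
    \<open>inverse q - 1\<close>, whose absolute value is the same.\<close>
  have "absv q = 1"
    using absv_add_le_max[of q "1 - q"] absv_add_le_max[of 1 "q - 1"] q(1)
    by (auto simp: absv_one absv_minus_commute[of q 1] max_def split: if_splits)
  moreover have q0: "q \<noteq> 0"
    using q(1) by (auto simp: absv_one)
  then have "inverse q - 1 = inverse q * (1 - q)"
    by (simp add: field_simps)
  ultimately have "absv (inverse q - 1) < 1"
    using q(1) by (simp add: absv_mult absv_inverse)
  then have lim_q: "(\<lambda>N. inverse q ^ (p ^ N)) \<longlonglongrightarrow> 1"
    by (rule tendsto_power_prime_power_one[OF _ p(2)])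
  have "(\<lambda>N. (- 1) * of_nat p ^ N :: 'a) \<longlonglongrightarrow> (- 1) * 0"
    by (intro tendsto_mult tendsto_const tendsto_power_zero_valued p)
  then have lim_p: "(\<lambda>N. - of_nat (p ^ N) :: 'a) \<longlonglongrightarrow> 0"
    by simp
  let ?S = "\<lambda>N. \<Sum>x<p ^ N. (1 - of_nat x) ^ n * (q * inverse q ^ x) * (- 1) ^ x"
  let ?R = "\<lambda>N. \<Sum>i=0..n. fps_nth D i *
      (inverse q ^ (p ^ N) * ((- of_nat (p ^ N)) ^ (n - i) * inverse (fact (n - i))))"
  have S_eq: "?S N = inverse 2 * fact n * (fps_nth D n + ?R N)" for N
  proof -
    let ?G = "\<Sum>x<p ^ N. fps_const (q * inverse q ^ x * (- 1) ^ x) * fps_exp (1 - of_nat x)"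
    have "2 * ?G = D + D * (fps_const (inverse q ^ (p ^ N)) * fps_exp (- of_nat (p ^ N)))"
      unfolding D_def w_def
      by (rule moment_generating_function) (use q0 q(2) p(1) in auto)
    from arg_cong[OF this, of "\<lambda>F. fps_nth F n"]
    have G_nth: "fps_nth ?G n + fps_nth ?G n = fps_nth D n
        + fps_nth (D * (fps_const (inverse q ^ (p ^ N)) * fps_exp (- of_nat (p ^ N)))) n"
      by (simp only: mult_2 fps_add_nth)
    have R_nth: "fps_nth (D * (fps_const (inverse q ^ (p ^ N)) * fps_exp (- of_nat (p ^ N)))) n
        = ?R N"
      by (subst fps_mult_nth) (simp only: fps_mult_left_const_nth fps_exp_nth of_nat_fact divide_inverse)
    have cancel: "fact n * (c * (z / fact n)) = z * c" for c z :: 'a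
      by simp
    have half: "c * z = inverse 2 * c * (z + z)" for c z :: 'a
      by (simp add: field_simps)
    have "?S N = fact n * fps_nth ?G n"
      by (simp only: fps_sum_nth sum_distrib_left fps_mult_left_const_nth fps_exp_nth of_nat_fact
          cancel) (simp only: mult.assoc)
    also have "\<dots> = inverse 2 * fact n * (fps_nth ?G n + fps_nth ?G n)"
      by (rule half)
    also have "\<dots> = inverse 2 * fact n * (fps_nth D n + ?R N)"
      by (simp only: G_nth R_nth)
    finally show ?thesis .
  qed
  \<comment> \<open>As \<open>0 ^ (n - i)\<close> vanishes except at \<open>i = n\<close>, the limit
    is the coefficient of \<open>D * fps_exp 0\<close>, that is, of \<open>D\<close>.\<close>
  have "?R \<longlonglongrightarrow> (\<Sum>i=0..n. fps_nth D i * (1 * (0 ^ (n - i) * inverse (fact (n - i)))))"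
    by (intro tendsto_sum tendsto_mult tendsto_const lim_q tendsto_power_valued lim_p)
  also have "(\<Sum>i=0..n. fps_nth D i * (1 * (0 ^ (n - i) * inverse (fact (n - i)))))
      = fps_nth (D * fps_exp 0) n"
    by (simp only: fps_mult_nth fps_exp_nth of_nat_fact divide_inverse mult_1)
  also have "\<dots> = fps_nth D n" by simp
  finally have "?R \<longlonglongrightarrow> fps_nth D n" .
  then have "?S \<longlonglongrightarrow> inverse 2 * fact n * (fps_nth D n + fps_nth D n)"
    unfolding S_eq by (intro tendsto_mult tendsto_add tendsto_const)
  also have "inverse 2 * fact n * (fps_nth D n + fps_nth D n) = fact n * fps_nth D n"
    by (simp add: field_simps)
  also have "\<dots> = 2 * q - (if n = 0 then 2 else 0) + q_Euler n q"
  proof -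
    have "fps_nth (2 * w) n = 2 * (q / fact n)"
      by (simp add: w_def numeral_fps_const)
    moreover have "fps_nth (2 :: 'a fps) n = (if n = 0 then 2 else 0)"
      by (rule fps_numeral_nth)
    moreover have "fact n * fps_nth (fps_const 2 / (w + 1)) n = q_Euler n q"
      by (simp add: q_Euler_def w_def)
    ultimately show ?thesis
      by (auto simp: D_def distrib_left right_diff_distrib)
  qed
  finally show ?thesis .
qed

section \<open>The p-adic absolute value of natural numbers\<close>

lemma padic_abs_of_nat:
  assumes "m \<noteq> 0"
  shows "padic_abs p (of_nat m) = real p powi - int (multiplicity (int p) (int m))"
proof -
  have "quotient_of (of_nat m) = (int m, 1)"
    using quotient_of_int[of "int m"] by (simp add: Rat.of_int_def)
  then show ?thesis
    using assms by (simp add: padic_abs_def)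
qed

lemma is_Cp_absv_of_nat:
  assumes "is_Cp p TYPE('a::valued_field)" and "m \<noteq> 0"
  shows "absv (of_nat m :: 'a) = real p powi - int (multiplicity (int p) (int m))"
proof -
  have "absv (of_rat (of_nat m) :: 'a) = padic_abs p (of_nat m)"
    using assms(1) unfolding is_Cp_def by blast
  then show ?thesis
    by (simp add: padic_abs_of_nat[OF assms(2)])
qed

section \<open>Products of Bernstein polynomials in powers of 1 - x\<close>

lemma power_mult_one_minus_power:
  fixes x :: "'a::comm_ring_1"
  assumes "m \<le> L"
  shows "x ^ m * (1 - x) ^ (L - m)
    = (\<Sum>j=0..m. of_nat (m choose j) * (- 1) ^ (m + j) * (1 - x) ^ (L - j))"
proof -
  have "x ^ m = (1 + - (1 - x)) ^ m" by simp
  also have "\<dots> = (\<Sum>j=0..m. of_nat (m choose j) * (- 1) ^ (m - j) * (1 - x) ^ (m - j))"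
    by (subst binomial_ring) (simp add: atLeast0AtMost power_minus[of "1 - x"] mult.assoc del: minus_diff_eq)
  finally have "x ^ m * (1 - x) ^ (L - m)
      = (\<Sum>j=0..m. of_nat (m choose j) * (- 1) ^ (m - j) * ((1 - x) ^ (m - j) * (1 - x) ^ (L - m)))"
    by (simp add: sum_distrib_right mult.assoc)
  \<comment> \<open>For \<open>j\<close> \<le> \<open>m\<close> the numbers m - j and m + j have the
    same parity, and the two exponents of 1 - x add up to L - j.\<close>
  also have "\<dots> = (\<Sum>j=0..m. of_nat (m choose j) * (- 1) ^ (m + j) * (1 - x) ^ (L - j))"
    using assms by (intro sum.cong) (auto simp: minus_one_power_iff simp flip: power_add)
  finally show ?thesis .
qed

text \<open>If some \<open>n i < k\<close>, truncated subtraction spoils the addition of exponents,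
  but then a binomial coefficient makes both sides zero.\<close>

lemma prod_bernstein:
  fixes x :: "'a::field_char_0"
  shows "(\<Prod>i=1..s. bernstein k (n i) x)
    = (\<Prod>i=1..s. of_nat (n i choose k)) * (x ^ (s * k) * (1 - x) ^ ((\<Sum>i=1..s. n i) - s * k))"
proof (cases "\<forall>i\<in>{1..s}. k \<le> n i")
  case True
  then have "(\<Sum>i=1..s. n i - k) = (\<Sum>i=1..s. n i) - s * k"
    by (subst sum_subtractf_nat) auto
  then show ?thesis
    by (simp add: bernstein_def prod.distrib mult.assoc power_mult mult.commute[of s]
        flip: power_sum)
next
  case False
  then obtain i where i: "i \<in> {1..s}" "n i < k" by auto
  then have "(\<Prod>i=1..s. bernstein k (n i) x) = 0"
    by (intro prod_zero) (auto simp: bernstein_def intro!: bexI[of _ i])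
  moreover have "(\<Prod>i=1..s. of_nat (n i choose k) :: 'a) = 0"
    using i by (intro prod_zero) (auto intro!: bexI[of _ i])
  ultimately show ?thesis by (simp only: mult_zero_left)
qed

section \<open>Evaluation of the integral\<close>

theorem theorem8:
  fixes p s k :: nat and n :: "nat \<Rightarrow> nat" and q :: "'a::valued_field"
  assumes "prime p" and "odd p"
    and "is_Cp p TYPE('a)"
    and "absv (1 - q) < 1"
    and "s \<ge> 1"
    and "(\<Sum>i=1..s. n i) > s * k"
  shows "has_fermionic_integral p
           (\<lambda>x. (\<Prod>i=1..s. bernstein k (n i) x) * (q * qpow (inverse q) x))
           (if k = 0 then 2 * q + q_Euler (\<Sum>i=1..s. n i) q
            else (\<Prod>i=1..s. of_nat (n i choose k)) *
              (\<Sum>j=0..s * k. of_nat ((s * k) choose j) * (- 1) ^ (s * k + j)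
                 * q_Euler ((\<Sum>i=1..s. n i) - j) q))"
proof -
  define L where "L = (\<Sum>i=1..s. n i)"
  define C :: 'a where "C = (\<Prod>i=1..s. of_nat (n i choose k))"
  define m where "m = s * k"
  define b :: "nat \<Rightarrow> 'a" where "b j = of_nat (m choose j) * (- 1) ^ (m + j)" for j
  have mL: "m < L" using assms(6) by (simp add: m_def L_def)
  have p1: "p > 1" using assms(1) by (rule prime_gt_1_nat)
  have "multiplicity (int p) (int p) = 1"
    using p1 by (intro multiplicity_self) auto
  then have absv_p: "absv (of_nat p :: 'a) < 1"
    using is_Cp_absv_of_nat[OF assms(3), of p] p1 by (simp add: power_int_minus inverse_less_1_iff)
  \<comment> \<open>For odd \<open>p\<close> the number 2 has absolute value 1. If 1 + q were 0,
    then 1 - q would be 2, against the bound on \<open>1 - q\<close>.\<close>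
  have "\<not> p dvd 2"
    using assms(1,2) by (metis primes_dvd_imp_eq two_is_prime_nat even_numeral dvd_refl)
  then have "\<not> int p dvd 2"
    using int_dvd_int_iff[of p 2] by simp
  then have "absv (2 :: 'a) = 1"
    using is_Cp_absv_of_nat[OF assms(3), of 2] by (simp add: not_dvd_imp_multiplicity_0)
  then have q1: "1 + q \<noteq> 0"
    using assms(4) by (metis add_eq_0_iff diff_minus_eq_add one_add_one order_less_irrefl)
  let ?T = "\<lambda>l N. \<Sum>x<p ^ N. (1 - of_nat x) ^ l * (q * inverse q ^ x) * (- 1) ^ x"
  \<comment> \<open>The strict inequality \<open>m < L\<close> keeps L - j positive, so the
    exceptional zeroth moment never occurs.\<close>
  have lim: "?T (L - j) \<longlonglongrightarrow> 2 * q + q_Euler (L - j) q" if "j \<in> {0..m}" for j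
    using moment_limit[OF assms(2) absv_p assms(4) q1, of "L - j"] that mL by simp
  have "(\<Sum>x<p ^ N. (\<Prod>i=1..s. bernstein k (n i) (of_nat x)) * (q * qpow (inverse q) (of_nat x)) * (- 1) ^ x)
      = C * (\<Sum>j=0..m. b j * ?T (L - j) N)" for N
  proof -
    have "(\<Sum>x<p ^ N. (\<Prod>i=1..s. bernstein k (n i) (of_nat x)) * (q * qpow (inverse q) (of_nat x)) * (- 1) ^ x)
      = (\<Sum>x<p ^ N. \<Sum>j=0..m. C * (b j * ((1 - of_nat x) ^ (L - j) * (q * inverse q ^ x) * (- 1) ^ x)))"
      unfolding prod_bernstein qpow_of_nat L_def [symmetric] C_def [symmetric] m_def [symmetric]
        power_mult_one_minus_power[OF less_imp_le[OF mL]] b_def [symmetric]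
      by (simp only: sum_distrib_left sum_distrib_right mult.assoc)
    also have "\<dots> = C * (\<Sum>j=0..m. b j * ?T (L - j) N)"
      by (subst sum.swap) (simp add: sum_distrib_left)
    finally show ?thesis .
  qed
  moreover have "(\<lambda>N. C * (\<Sum>j=0..m. b j * ?T (L - j) N))
      \<longlonglongrightarrow> C * (\<Sum>j=0..m. b j * (2 * q + q_Euler (L - j) q))"
    by (intro tendsto_mult tendsto_sum tendsto_const lim)
  moreover have "C * (\<Sum>j=0..m. b j * (2 * q + q_Euler (L - j) q)) =
      (if k = 0 then 2 * q + q_Euler L q else C * (\<Sum>j=0..m. b j * q_Euler (L - j) q))"
  \<comment> \<open>The terms 2 q contribute 2 q times the sum of the \<open>b j\<close>, which is
    (1 - 1)^m. For \<open>k = 0\<close> this is 1 and 2 q survives; otherwise it vanishes.\<close>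
  proof (cases "k = 0")
    case True
    then show ?thesis by (simp add: m_def b_def C_def)
  next
    case False
    then have "m > 0" using assms(5) by (simp add: m_def)
    moreover have "(\<Sum>j=0..m. b j) = 0 ^ m"
      \<comment> \<open>Evaluating the expansion at x = 0 with L = m leaves exactly the sum of the
        \<open>b j\<close>.\<close>
      using power_mult_one_minus_power[of m m "0 :: 'a"] by (simp add: b_def)
    ultimately have "(\<Sum>j=0..m. b j) = 0"
      by (simp add: zero_power)
    then have "(\<Sum>j=0..m. b j * (2 * q)) = 0"
      by (simp flip: sum_distrib_right)
    then show ?thesis
      using False by (simp add: distrib_left sum.distrib)
  qed
  ultimately show ?thesis
    unfolding has_fermionic_integral_def L_def [symmetric] C_def [symmetric] m_def [symmetric]
      b_def [symmetric] by (simp only:)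
qed

end
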